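(* For every integer $n\ge 3$ there exists a Heffter array $H(3,n)$. If moreover $n\equiv 0,1\pmod 4$, then the array can be taken to be an integer Heffter array.
   Context: A (tight) Heffter array $H(m,n)$ is an $m\times n$ array with every cell filled by an element of $\mathbb{Z}_{2mn+1}$ such that every row and every column sums to $0$ modulo $2mn+1$, and no element of any pair $\{x,-x\}$ appears twice (using representatives $-mn,\dots,mn$, entries are nonzero and each of $1,\dots,mn$ appears exactly once up to sign). An integer Heffter array $H(m,n)$ is an $m\times n$ array with entries from $\{-mn,\dots,mn\}$ such that every row and column sums to $0$ over the integers and no element from any $\{x,-x\}$ appears twice, so the multiset of absolute values of entries is $\{1,\dots,mn\}$. *)

theory Defs
  imports "HOL-Number_Theory.Cong"
begin

text \<open>
  An m x n array is a function \<open>A :: nat \<Rightarrow> nat \<Rightarrow> int\<close> of which only the cells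
  \<open>i < m\<close>, \<open>j < n\<close> matter. An element of the integers modulo 2mn+1 is given by its unique
  representative in \<open>{- mn..mn}\<close>; as this range is symmetric, negation modulo 2mn+1 is
  integer negation of representatives.
\<close>

definition heffter_filling :: "nat \<Rightarrow> nat \<Rightarrow> (nat \<Rightarrow> nat \<Rightarrow> int) \<Rightarrow> bool" where
  "heffter_filling m n A \<longleftrightarrow>
     (\<forall>i<m. \<forall>j<n. A i j \<in> {- int (m * n)..int (m * n)} \<and> A i j \<noteq> 0) \<and>
     (\<forall>i<m. \<forall>j<n. \<forall>i'<m. \<forall>j'<n.
        (i, j) \<noteq> (i', j') \<longrightarrow> A i j \<noteq> A i' j' \<and> A i j \<noteq> - A i' j')"

definition heffter_array :: "nat \<Rightarrow> nat \<Rightarrow> (nat \<Rightarrow> nat \<Rightarrow> int) \<Rightarrow> bool" where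
  "heffter_array m n A \<longleftrightarrow>
     heffter_filling m n A \<and>
     (\<forall>i<m. [(\<Sum>j<n. A i j) = 0] (mod int (2 * m * n + 1))) \<and>
     (\<forall>j<n. [(\<Sum>i<m. A i j) = 0] (mod int (2 * m * n + 1)))"

definition integer_heffter_array :: "nat \<Rightarrow> nat \<Rightarrow> (nat \<Rightarrow> nat \<Rightarrow> int) \<Rightarrow> bool" where
  "integer_heffter_array m n A \<longleftrightarrow>
     heffter_filling m n A \<and>
     (\<forall>i<m. (\<Sum>j<n. A i j) = 0) \<and>
     (\<forall>j<n. (\<Sum>i<m. A i j) = 0)"

lemma heffter_filling_iff_bij_betw:
  "heffter_filling m n A \<longleftrightarrow>
     bij_betw (\<lambda>(i, j). \<bar>A i j\<bar>) ({..<m} \<times> {..<n}) {1..int (m * n)}"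
  (is "?L \<longleftrightarrow> bij_betw ?f ?C ?I")
proof
  assume L: ?L
  have "inj_on ?f ?C"
    using L unfolding heffter_filling_def inj_on_def by (auto simp: abs_eq_iff) blast+
  moreover have sub: "?f ` ?C \<subseteq> ?I"
    using L unfolding heffter_filling_def by (fastforce simp: abs_le_iff)
  ultimately have "card (?f ` ?C) = card ?I"
    by (simp add: card_image card_cartesian_product nat_mult_distrib)
  then have "?f ` ?C = ?I"
    using sub by (intro card_subset_eq) auto
  with \<open>inj_on ?f ?C\<close> show "bij_betw ?f ?C ?I"
    by (simp add: bij_betw_def)
next
  assume R: "bij_betw ?f ?C ?I"
  have rng: "\<bar>A i j\<bar> \<in> ?I" if "i < m" "j < n" for i j
    using bij_betwE[OF R] that by force
  have inj: "(i, j) = (i', j')"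
    if "i < m" "j < n" "i' < m" "j' < n" "\<bar>A i j\<bar> = \<bar>A i' j'\<bar>" for i j i' j'
    using inj_onD[OF bij_betw_imp_inj_on[OF R], of "(i, j)" "(i', j')"] that by auto
  have range: "A i j \<in> {- int (m * n)..int (m * n)} \<and> A i j \<noteq> 0" if "i < m" "j < n" for i j
    using rng[OF that] by (auto simp: abs_if split: if_splits)
  have distinct: "A i j \<noteq> A i' j' \<and> A i j \<noteq> - A i' j'"
    if "i < m" "j < n" "i' < m" "j' < n" "(i, j) \<noteq> (i', j')" for i j i' j'
    using inj[OF that(1-4)] that(5) by auto
  show ?L
    unfolding heffter_filling_def using range distinct by blast
qed

lemma integer_heffter_array_imp_heffter_array:
  "integer_heffter_array m n A \<Longrightarrow> heffter_array m n A"
  by (simp add: integer_heffter_array_def heffter_array_def)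

end

theory Submission
  imports Defs
begin

text \<open>
  The columns are triples \<open>\<plusminus> (d, n + a, - (n + b))\<close>, suitably permuted, where the pairs
  \<open>(a, b)\<close> with \<open>b - a = d\<close> come from a Skolem sequence (\<open>n \<equiv> 0, 1\<close> mod 4) or a hooked Skolem
  sequence (\<open>n \<equiv> 2, 3\<close> mod 4); in the latter \<open>3 n + 1\<close> occurs in place of \<open>3 n\<close>, and
  \<open>3 n + 1 \<equiv> - 3 n\<close> modulo \<open>6 n + 1\<close>. Up to a bounded number of columns, the standard sequences
  consist of one family with even \<open>d\<close>, twice as long as each of two families with odd \<open>d\<close>. All
  families are linear in the index \<open>r\<close> with the same slope. Cut the even family into two halves and
  take from the four resulting families the columns of index \<open>r\<close> with signs \<open>+ - - +\<close>: their row
  sums are constants independent of \<open>r\<close> and \<open>n\<close>. Signs and permutations of the few remaining columns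
  that compensate these constants were found by computer search.
\<close>

section \<open>Three-row arrays as lists of columns\<close>

definition array_of_columns :: "(int \<times> int \<times> int) list \<Rightarrow> nat \<Rightarrow> nat \<Rightarrow> int" where
  "array_of_columns cs i j = (case cs ! j of (a, b, c) \<Rightarrow> if i = 0 then a else if i = 1 then b else c)"

text \<open>Closure under negation lets a positive \<open>x\<close> be recognised as the absolute
  value of an entry by linear equations alone.\<close>

fun signed_entries :: "int \<times> int \<times> int \<Rightarrow> int set" where
  "signed_entries (a, b, c) = {a, b, c, - a, - b, - c}"

lemma less_3_cases: "i < 3 \<longleftrightarrow> i = 0 \<or> i = 1 \<or> i = (2::nat)"
  by auto

text \<open>A covering of \<open>3 n\<close> values by \<open>3 n\<close> cells is automatically bijective.\<close>

lemma heffter_filling_array_of_columns: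
  assumes cover: "\<And>x. 1 \<le> x \<Longrightarrow> x \<le> 3 * int (length cs) \<Longrightarrow> \<exists>c\<in>set cs. x \<in> signed_entries c"
  shows "heffter_filling 3 (length cs) (array_of_columns cs)"
proof -
  let ?A = "array_of_columns cs" and ?n = "length cs"
  let ?f = "\<lambda>(i, j). \<bar>?A i j\<bar>" and ?C = "{..<3} \<times> {..<?n}" and ?I = "{1..int (3 * ?n)}"
  have sub: "?I \<subseteq> ?f ` ?C"
  proof
    fix x assume x: "x \<in> ?I"
    then obtain c where "c \<in> set cs" "x \<in> signed_entries c"
      using cover[of x] by auto
    then obtain j where j: "j < ?n" "x \<in> signed_entries (cs ! j)"
      by (auto simp: in_set_conv_nth)
    obtain a b d where c: "cs ! j = (a, b, d)"
      by (cases "cs ! j")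
    have "\<exists>i<3. x = \<bar>?A i j\<bar>"
    proof -
      consider "x = \<bar>a\<bar>" | "x = \<bar>b\<bar>" | "x = \<bar>d\<bar>"
        using x j c by auto
      then show ?thesis
      proof cases
        case 1 then show ?thesis using c by (intro exI[of _ 0]) (simp add: array_of_columns_def)
      next
        case 2 then show ?thesis using c by (intro exI[of _ 1]) (simp add: array_of_columns_def)
      next
        case 3 then show ?thesis using c by (intro exI[of _ 2]) (simp add: array_of_columns_def)
      qed
    qed
    with j show "x \<in> ?f ` ?C" by force
  qed
  have card: "card (?f ` ?C) \<le> card ?I"
    using card_image_le[of ?C ?f] by (simp add: card_cartesian_product)
  have eq: "?f ` ?C = ?I"
    using card_seteq[OF _ sub card] by simp
  moreover have "inj_on ?f ?C"
    by (rule eq_card_imp_inj_on) (simp_all add: eq card_cartesian_product)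
  ultimately show ?thesis
    unfolding heffter_filling_iff_bij_betw by (simp add: bij_betw_def)
qed

lemma row_sum_array_of_columns:
  fixes N :: int
  assumes "i < 3"
    and "N dvd sum_list (map fst cs)" "N dvd sum_list (map (fst \<circ> snd) cs)"
      "N dvd sum_list (map (snd \<circ> snd) cs)"
  shows "N dvd (\<Sum>j<length cs. array_of_columns cs i j)"
  using assms
  by (auto simp: less_3_cases array_of_columns_def sum_list_sum_nth atLeast0LessThan case_prod_beta)

lemma column_sum_array_of_columns:
  "(\<Sum>i<3. array_of_columns cs i j) = (case cs ! j of (a, b, c) \<Rightarrow> a + b + c)"
  by (auto simp: array_of_columns_def numeral_3_eq_3 split: prod.split)

text \<open>One divisor serves both notions: \<open>0 dvd x\<close> means \<open>x = 0\<close>, the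
  integer case, and \<open>6 * int (length cs) + 1\<close> is the Heffter modulus for three
  rows.\<close>

lemma heffter_array_of_columns:
  fixes N :: int
  assumes "\<And>x. 1 \<le> x \<Longrightarrow> x \<le> 3 * int (length cs) \<Longrightarrow> \<exists>c\<in>set cs. x \<in> signed_entries c"
    and "N dvd sum_list (map fst cs)" "N dvd sum_list (map (fst \<circ> snd) cs)"
      "N dvd sum_list (map (snd \<circ> snd) cs)"
    and col: "\<And>a b c. (a, b, c) \<in> set cs \<Longrightarrow> N dvd a + b + c"
  shows "N = 0 \<Longrightarrow> integer_heffter_array 3 (length cs) (array_of_columns cs)"
    and "N = 6 * int (length cs) + 1 \<Longrightarrow> heffter_array 3 (length cs) (array_of_columns cs)"
proof -
  let ?A = "array_of_columns cs"
  have fill: "heffter_filling 3 (length cs) ?A"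
    by (rule heffter_filling_array_of_columns) (rule assms(1))
  have rows: "N dvd (\<Sum>j<length cs. ?A i j)" if "i < 3" for i
    using row_sum_array_of_columns[OF that] assms(2-4) .
  have cols: "N dvd (\<Sum>i<3. ?A i j)" if "j < length cs" for j
    using col[of "fst (cs ! j)" "fst (snd (cs ! j))" "snd (snd (cs ! j))"] that
    by (simp add: column_sum_array_of_columns case_prod_beta)
  show "integer_heffter_array 3 (length cs) ?A" if "N = 0"
    using fill rows cols that by (simp add: integer_heffter_array_def)
  show "heffter_array 3 (length cs) ?A" if "N = 6 * int (length cs) + 1"
    using fill rows cols that by (simp add: heffter_array_def cong_0_iff algebra_simps)
qed

section \<open>A fixed number of special columns followed by \<open>k\<close> blocks of four\<close>

lemma sum_list_map_blocks:
  "(\<And>r. sum_list (map f (B r)) = s) \<Longrightarrow>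
    sum_list (map f (concat (map (\<lambda>r. B (int r)) [0..<k]))) = int k * s" for s :: int
  by (induction k) (simp_all add: algebra_simps)

text \<open>Constant block row sums reduce each row condition to one linear condition in
  \<open>k\<close>. Columns of \<open>S\<close> need only vanish modulo \<open>N\<close>, which
  admits the hooked column. Coverage is stated as a refutation, so that an uncovered
  \<open>x\<close> is excluded by instantiating \<open>r\<close> at a value solved from
  \<open>x\<close>.\<close>

lemma heffter_array_of_blocks:
  fixes n k :: nat and S :: "(int \<times> int \<times> int) list" and N p q s :: int
  assumes n_eq: "n = length S + 4 * k"
    and len: "\<And>r. length (B r) = 4"
    and cover: "\<And>x. 1 \<le> x \<Longrightarrow> x \<le> 3 * int n \<Longrightarrow>
      \<forall>c\<in>set S. x \<notin> signed_entries c \<Longrightarrow>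
      (\<And>r. 0 \<le> r \<Longrightarrow> r < int k \<Longrightarrow> \<forall>c\<in>set (B r). x \<notin> signed_entries c) \<Longrightarrow> False"
    and rowB: "\<And>r. sum_list (map fst (B r)) = p" "\<And>r. sum_list (map (fst \<circ> snd) (B r)) = q"
      "\<And>r. sum_list (map (snd \<circ> snd) (B r)) = s"
    and rowS: "N dvd sum_list (map fst S) + int k * p"
      "N dvd sum_list (map (fst \<circ> snd) S) + int k * q"
      "N dvd sum_list (map (snd \<circ> snd) S) + int k * s"
    and colB: "\<And>r. \<forall>(a, b, c)\<in>set (B r). a + b + c = 0"
    and colS: "\<forall>(a, b, c)\<in>set S. N dvd a + b + c"
  shows "N = 0 \<Longrightarrow> \<exists>A. integer_heffter_array 3 n A"
    and "N = 6 * int n + 1 \<Longrightarrow> \<exists>A. heffter_array 3 n A"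
proof -
  define cs where "cs = S @ concat (map (\<lambda>r. B (int r)) [0..<k])"
  have n: "length cs = n"
    by (simp add: cs_def n_eq length_concat len comp_def sum_list_triv)
  have cover': "\<exists>c\<in>set cs. x \<in> signed_entries c" if x: "1 \<le> x" "x \<le> 3 * int (length cs)" for x
  proof (rule ccontr)
    assume no: "\<not> ?thesis"
    have "\<forall>c\<in>set (B r). x \<notin> signed_entries c" if "0 \<le> r" "r < int k" for r
    proof -
      have "set (B r) \<subseteq> set cs"
        using that by (force simp: cs_def intro!: bexI[of _ "nat r"])
      with no show ?thesis by blast
    qed
    moreover have "\<forall>c\<in>set S. x \<notin> signed_entries c"
      using no by (simp add: cs_def)
    ultimately show False
      using cover[of x] x unfolding n by blast
  qed
  have rows: "N dvd sum_list (map fst cs)" "N dvd sum_list (map (fst \<circ> snd) cs)"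
    "N dvd sum_list (map (snd \<circ> snd) cs)"
    unfolding cs_def map_append sum_list_append
    using rowS by (simp_all only: sum_list_map_blocks[where B = B, OF rowB(1)]
        sum_list_map_blocks[where B = B, OF rowB(2)] sum_list_map_blocks[where B = B, OF rowB(3)])
  have cols: "N dvd a + b + c" if "(a, b, c) \<in> set cs" for a b c
    using that colB colS by (fastforce simp: cs_def)
  note arr = heffter_array_of_columns[OF cover' rows cols, unfolded n]
  show "\<exists>A. integer_heffter_array 3 n A" if "N = 0"
    using arr(1) that by blast
  show "\<exists>A. heffter_array 3 n A" if "N = 6 * int n + 1"
    using arr(2) that by blast
qed

section \<open>Orders 2 and 3 modulo 4, from hooked Skolem sequences\<close>

lemma heffter_array_3_4k_plus_6:
  "\<exists>A. heffter_array 3 (4 * k + 6) A"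
proof -
  \<comment> \<open>The third column carries the hook: \<open>8 * k + 13\<close> and
    \<open>4 * k + 6\<close> add up to \<open>3 n + 1\<close>, and with
    \<open>3 n = 12 * k + 18\<close> to the modulus. The last two columns are the middle and final
    members of the even family (\<open>d = 2 * k + 4\<close> and \<open>d = 2\<close>).\<close>
  define S :: "int \<Rightarrow> (int \<times> int \<times> int) list" where "S = (\<lambda>k.
     [(-4 * k - 5, -6 * k - 9, 10 * k + 14),
      (-8 * k - 12, 10 * k + 15, -2 * k - 3),
      (12 * k + 18, 8 * k + 13, 4 * k + 6),
      (11 * k + 16, -11 * k - 17, 1),
      (-5 * k - 7, -2 * k - 4, 7 * k + 11),
      (-6 * k - 10, 2, 6 * k + 8)])"
  \<comment> \<open>The first two columns run through the halves of the even family, the last two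
    through the odd families, with signs \<open>- + + -\<close>. In each row the coefficients of
    \<open>k\<close> and of \<open>r\<close> cancel.\<close>
  define B :: "int \<Rightarrow> int \<Rightarrow> (int \<times> int \<times> int) list" where "B = (\<lambda>k r.
     [(-4 * k + 2 * r - 4, -4 * k - r - 7, 8 * k - r + 11),
      (2 * k - 2 * r + 2, 5 * k + r + 8, -7 * k + r - 10),
      (4 * k - 2 * r + 3, 8 * k + r + 14, -12 * k + r - 17),
      (-2 * k + 2 * r - 1, -9 * k - r - 14, 11 * k - r + 15)])"
  have cover: False
    if k: "0 \<le> k" and x: "1 \<le> x" "x \<le> 12 * k + 18"
      and S: "\<forall>c\<in>set (S k). x \<notin> signed_entries c"
      and B: "\<And>r. 0 \<le> r \<Longrightarrow> r < k \<Longrightarrow> \<forall>c\<in>set (B k r). x \<notin> signed_entries c" for k x :: int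
  proof -
    note B = B[unfolded B_def, simplified]
    \<comment> \<open>Each of the twelve block entries excludes one progression; the instance solves
      "entry = x" for \<open>r\<close>. The differences move in steps of 2, hence the parity
      premises in \<open>i1\<close> to \<open>i4\<close>; the other entries sweep full
      intervals.\<close>
    have i1: "odd x \<longrightarrow> \<not> (3 \<le> x \<and> x \<le> 2 * k + 1)"
      using B[of "(2 * k + 1 - x) div 2"] by (auto elim!: evenE oddE)
    have i2: "even x \<longrightarrow> \<not> (4 \<le> x \<and> x \<le> 2 * k + 2)"
      using B[of "(2 * k + 2 - x) div 2"] by (auto elim!: evenE oddE)
    have i3: "odd x \<longrightarrow> \<not> (2 * k + 5 \<le> x \<and> x \<le> 4 * k + 3)"
      using B[of "(4 * k + 3 - x) div 2"] by (auto elim!: evenE oddE)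
    have i4: "even x \<longrightarrow> \<not> (2 * k + 6 \<le> x \<and> x \<le> 4 * k + 4)"
      using B[of "(4 * k + 4 - x) div 2"] by (auto elim!: evenE oddE)
    have i5: "\<not> (4 * k + 7 \<le> x \<and> x \<le> 5 * k + 6)"
      using B[of "x - (4 * k + 7)"] by auto
    have i6: "\<not> (5 * k + 8 \<le> x \<and> x \<le> 6 * k + 7)"
      using B[of "x - (5 * k + 8)"] by auto
    have i7: "\<not> (6 * k + 11 \<le> x \<and> x \<le> 7 * k + 10)"
      using B[of "7 * k + 10 - x"] by auto
    have i8: "\<not> (7 * k + 12 \<le> x \<and> x \<le> 8 * k + 11)"
      using B[of "8 * k + 11 - x"] by auto
    have i9: "\<not> (8 * k + 14 \<le> x \<and> x \<le> 9 * k + 13)"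
      using B[of "x - (8 * k + 14)"] by auto
    have i10: "\<not> (9 * k + 14 \<le> x \<and> x \<le> 10 * k + 13)"
      using B[of "x - (9 * k + 14)"] by auto
    have i11: "\<not> (10 * k + 16 \<le> x \<and> x \<le> 11 * k + 15)"
      using B[of "11 * k + 15 - x"] by auto
    have i12: "\<not> (11 * k + 18 \<le> x \<and> x \<le> 12 * k + 17)"
      using B[of "12 * k + 17 - x"] by auto
    note S = S[unfolded S_def, simplified]
    \<comment> \<open>The absolute values in \<open>S\<close> fill exactly the gaps between the
      progressions. Splitting by parity leaves linear arithmetic.\<close>
    obtain y where "x = 2 * y \<or> x = 2 * y + 1"
      by (metis evenE oddE)
    then show False
      using k x S i1 i2 i3 i4 i5 i6 i7 i8 i9 i10 i11 i12 by (elim disjE; simp; smt (z3))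
  qed
  \<comment> \<open>The rows of \<open>S\<close> sum to \<open>0\<close>, \<open>- k\<close> and
    \<open>25 * k + 37\<close>; with the blocks the totals are \<open>0\<close>, \<open>0\<close>
    and \<open>N\<close>.\<close>
  show ?thesis
  proof (rule heffter_array_of_blocks(2)[where S = "S (int k)" and B = "B (int k)"
        and k = k and p = "0" and q = "1" and s = "-1" and N = "24 * int k + 37"])
    show False
      if "1 \<le> x" "x \<le> 3 * int (4 * k + 6)" "\<forall>c\<in>set (S (int k)). x \<notin> signed_entries c"
        and "\<And>r. 0 \<le> r \<Longrightarrow> r < int k \<Longrightarrow> \<forall>c\<in>set (B (int k) r). x \<notin> signed_entries c" for x
      using cover[of "int k" x] that by simp
  qed (simp_all add: S_def B_def algebra_simps)
qed

lemma heffter_array_3_4k_plus_7: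
  "\<exists>A. heffter_array 3 (4 * k + 7) A"
proof -
  \<comment> \<open>The hook is in the fifth column, which sums to \<open>24 * k + 43\<close>. The
    last two columns are the tail \<open>d = 4, 2\<close> of the even family.\<close>
  define S :: "int \<Rightarrow> (int \<times> int \<times> int) list" where "S = (\<lambda>k.
     [(5 * k + 8, 2 * k + 5, -7 * k - 13),
      (5 * k + 9, -5 * k - 10, 1),
      (6 * k + 11, -8 * k - 14, 2 * k + 3),
      (-6 * k - 12, 10 * k + 18, -4 * k - 6),
      (4 * k + 7, 8 * k + 15, 12 * k + 21),
      (-4, -10 * k - 16, 10 * k + 20),
      (-10 * k - 19, 2, 10 * k + 17)])"
  \<comment> \<open>Here the even family uses the values from \<open>8 * k + 16\<close> upwards and
    the odd families the lower ones. The halves of the even family join without a gap: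
    \<open>r = k\<close> in the first column matches \<open>r = 0\<close> in the second up to
    sign.\<close>
  define B :: "int \<Rightarrow> int \<Rightarrow> (int \<times> int \<times> int) list" where "B = (\<lambda>k r.
     [(4 * k - 2 * r + 4, 8 * k + r + 16, -12 * k + r - 20),
      (-2 * k + 2 * r - 4, -9 * k - r - 16, 11 * k - r + 20),
      (-4 * k + 2 * r - 5, -4 * k - r - 8, 8 * k - r + 13),
      (2 * k - 2 * r + 1, 5 * k + r + 11, -7 * k + r - 12)])"
  have cover: False
    if k: "0 \<le> k" and x: "1 \<le> x" "x \<le> 12 * k + 21"
      and S: "\<forall>c\<in>set (S k). x \<notin> signed_entries c"
      and B: "\<And>r. 0 \<le> r \<Longrightarrow> r < k \<Longrightarrow> \<forall>c\<in>set (B k r). x \<notin> signed_entries c" for k x :: int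
  proof -
    note B = B[unfolded B_def, simplified]
    have i1: "odd x \<longrightarrow> \<not> (3 \<le> x \<and> x \<le> 2 * k + 1)"
      using B[of "(2 * k + 1 - x) div 2"] by (auto elim!: evenE oddE)
    have i2: "even x \<longrightarrow> \<not> (6 \<le> x \<and> x \<le> 2 * k + 4)"
      using B[of "(2 * k + 4 - x) div 2"] by (auto elim!: evenE oddE)
    have i3: "even x \<longrightarrow> \<not> (2 * k + 6 \<le> x \<and> x \<le> 4 * k + 4)"
      using B[of "(4 * k + 4 - x) div 2"] by (auto elim!: evenE oddE)
    have i4: "odd x \<longrightarrow> \<not> (2 * k + 7 \<le> x \<and> x \<le> 4 * k + 5)"
      using B[of "(4 * k + 5 - x) div 2"] by (auto elim!: evenE oddE)
    have i5: "\<not> (4 * k + 8 \<le> x \<and> x \<le> 5 * k + 7)"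
      using B[of "x - (4 * k + 8)"] by auto
    have i6: "\<not> (5 * k + 11 \<le> x \<and> x \<le> 6 * k + 10)"
      using B[of "x - (5 * k + 11)"] by auto
    have i7: "\<not> (6 * k + 13 \<le> x \<and> x \<le> 7 * k + 12)"
      using B[of "7 * k + 12 - x"] by auto
    have i8: "\<not> (7 * k + 14 \<le> x \<and> x \<le> 8 * k + 13)"
      using B[of "8 * k + 13 - x"] by auto
    have i9: "\<not> (8 * k + 16 \<le> x \<and> x \<le> 9 * k + 15)"
      using B[of "x - (8 * k + 16)"] by auto
    have i10: "\<not> (9 * k + 16 \<le> x \<and> x \<le> 10 * k + 15)"
      using B[of "x - (9 * k + 16)"] by auto
    have i11: "\<not> (10 * k + 21 \<le> x \<and> x \<le> 11 * k + 20)"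
      using B[of "11 * k + 20 - x"] by auto
    have i12: "\<not> (11 * k + 21 \<le> x \<and> x \<le> 12 * k + 20)"
      using B[of "12 * k + 20 - x"] by auto
    note S = S[unfolded S_def, simplified]
    obtain y where "x = 2 * y \<or> x = 2 * y + 1"
      by (metis evenE oddE)
    then show False
      using k x S i1 i2 i3 i4 i5 i6 i7 i8 i9 i10 i11 i12 by (elim disjE; simp; smt (z3))
  qed
  show ?thesis
  proof (rule heffter_array_of_blocks(2)[where S = "S (int k)" and B = "B (int k)"
        and k = k and p = "-4" and q = "3" and s = "1" and N = "24 * int k + 43"])
    show False
      if "1 \<le> x" "x \<le> 3 * int (4 * k + 7)" "\<forall>c\<in>set (S (int k)). x \<notin> signed_entries c"
        and "\<And>r. 0 \<le> r \<Longrightarrow> r < int k \<Longrightarrow> \<forall>c\<in>set (B (int k) r). x \<notin> signed_entries c" for x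
      using cover[of "int k" x] that by simp
  qed (simp_all add: S_def B_def algebra_simps)
qed

section \<open>Orders 0 and 1 modulo 4, from Skolem sequences\<close>

lemma integer_heffter_array_3_4k_plus_8:
  "\<exists>A. integer_heffter_array 3 (4 * k + 8) A"
proof -
  \<comment> \<open>Every column sums to 0 over the integers. The last four are the tail
    \<open>d = 8, 6, 4, 2\<close> of the even family. The row sums \<open>4 * k\<close>,
    \<open>-3 * k\<close>, \<open>- k\<close> of \<open>S\<close> cancel those of the
    blocks.\<close>
  define S :: "int \<Rightarrow> (int \<times> int \<times> int) list" where "S = (\<lambda>k.
     [(5 * k + 9, -7 * k - 14, 2 * k + 5),
      (5 * k + 10, 1, -5 * k - 11),
      (-6 * k - 12, 8 * k + 15, -2 * k - 3),
      (-10 * k - 20, 6 * k + 13, 4 * k + 7),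
      (10 * k + 16, 8, -10 * k - 24),
      (-6, -10 * k - 17, 10 * k + 23),
      (-10 * k - 18, -4, 10 * k + 22),
      (10 * k + 21, -2, -10 * k - 19)])"
  define B :: "int \<Rightarrow> int \<Rightarrow> (int \<times> int \<times> int) list" where "B = (\<lambda>k r.
     [(4 * k - 2 * r + 8, 8 * k + r + 16, -12 * k + r - 24),
      (-2 * k + 2 * r - 8, -9 * k - r - 16, 11 * k - r + 24),
      (-4 * k + 2 * r - 5, -4 * k - r - 9, 8 * k - r + 14),
      (2 * k - 2 * r + 1, 5 * k + r + 12, -7 * k + r - 13)])"
  have cover: False
    if k: "0 \<le> k" and x: "1 \<le> x" "x \<le> 12 * k + 24"
      and S: "\<forall>c\<in>set (S k). x \<notin> signed_entries c"
      and B: "\<And>r. 0 \<le> r \<Longrightarrow> r < k \<Longrightarrow> \<forall>c\<in>set (B k r). x \<notin> signed_entries c" for k x :: int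
  proof -
    note B = B[unfolded B_def, simplified]
    have i1: "odd x \<longrightarrow> \<not> (3 \<le> x \<and> x \<le> 2 * k + 1)"
      using B[of "(2 * k + 1 - x) div 2"] by (auto elim!: evenE oddE)
    have i2: "even x \<longrightarrow> \<not> (10 \<le> x \<and> x \<le> 2 * k + 8)"
      using B[of "(2 * k + 8 - x) div 2"] by (auto elim!: evenE oddE)
    have i3: "odd x \<longrightarrow> \<not> (2 * k + 7 \<le> x \<and> x \<le> 4 * k + 5)"
      using B[of "(4 * k + 5 - x) div 2"] by (auto elim!: evenE oddE)
    have i4: "even x \<longrightarrow> \<not> (2 * k + 10 \<le> x \<and> x \<le> 4 * k + 8)"
      using B[of "(4 * k + 8 - x) div 2"] by (auto elim!: evenE oddE)
    have i5: "\<not> (4 * k + 9 \<le> x \<and> x \<le> 5 * k + 8)"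
      using B[of "x - (4 * k + 9)"] by auto
    have i6: "\<not> (5 * k + 12 \<le> x \<and> x \<le> 6 * k + 11)"
      using B[of "x - (5 * k + 12)"] by auto
    have i7: "\<not> (6 * k + 14 \<le> x \<and> x \<le> 7 * k + 13)"
      using B[of "7 * k + 13 - x"] by auto
    have i8: "\<not> (7 * k + 15 \<le> x \<and> x \<le> 8 * k + 14)"
      using B[of "8 * k + 14 - x"] by auto
    have i9: "\<not> (8 * k + 16 \<le> x \<and> x \<le> 9 * k + 15)"
      using B[of "x - (8 * k + 16)"] by auto
    have i10: "\<not> (9 * k + 16 \<le> x \<and> x \<le> 10 * k + 15)"
      using B[of "x - (9 * k + 16)"] by auto
    have i11: "\<not> (10 * k + 25 \<le> x \<and> x \<le> 11 * k + 24)"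
      using B[of "11 * k + 24 - x"] by auto
    have i12: "\<not> (11 * k + 25 \<le> x \<and> x \<le> 12 * k + 24)"
      using B[of "12 * k + 24 - x"] by auto
    note S = S[unfolded S_def, simplified]
    obtain y where "x = 2 * y \<or> x = 2 * y + 1"
      by (metis evenE oddE)
    then show False
      using k x S i1 i2 i3 i4 i5 i6 i7 i8 i9 i10 i11 i12 by (elim disjE; simp; smt (z3))
  qed
  show ?thesis
  proof (rule heffter_array_of_blocks(1)[where S = "S (int k)" and B = "B (int k)"
        and k = k and p = "-4" and q = "3" and s = "1" and N = "0"])
    show False
      if "1 \<le> x" "x \<le> 3 * int (4 * k + 8)" "\<forall>c\<in>set (S (int k)). x \<notin> signed_entries c"
        and "\<And>r. 0 \<le> r \<Longrightarrow> r < int k \<Longrightarrow> \<forall>c\<in>set (B (int k) r). x \<notin> signed_entries c" for x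
      using cover[of "int k" x] that by simp
  qed (simp_all add: S_def B_def algebra_simps)
qed

lemma integer_heffter_array_3_4k_plus_9:
  "\<exists>A. integer_heffter_array 3 (4 * k + 9) A"
proof -
  \<comment> \<open>Columns four to seven are the even tail \<open>d = 8, 6, 4, 2\<close>; the last
    two continue the odd family of the third block column to \<open>r = k\<close> and
    \<open>r = k + 1\<close>. The row sums are \<open>6 * k\<close>, \<open>-4 * k\<close>,
    \<open>-2 * k\<close>.\<close>
  define S :: "int \<Rightarrow> (int \<times> int \<times> int) list" where "S = (\<lambda>k.
     [(1, 5 * k + 12, -5 * k - 13),
      (4 * k + 9, -10 * k - 23, 6 * k + 14),
      (2 * k + 3, -8 * k - 18, 6 * k + 15),
      (-8, -10 * k - 19, 10 * k + 27),
      (-6, -10 * k - 20, 10 * k + 26),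
      (4, 10 * k + 21, -10 * k - 25),
      (-2, 10 * k + 24, -10 * k - 22),
      (5 * k + 10, 2 * k + 7, -7 * k - 17),
      (-5 * k - 11, 7 * k + 16, -2 * k - 5)])"
  define B :: "int \<Rightarrow> int \<Rightarrow> (int \<times> int \<times> int) list" where "B = (\<lambda>k r.
     [(4 * k - 2 * r + 8, 8 * k + r + 19, -12 * k + r - 27),
      (-2 * k + 2 * r - 8, -9 * k - r - 19, 11 * k - r + 27),
      (-4 * k + 2 * r - 7, -4 * k - r - 10, 8 * k - r + 17),
      (2 * k - 2 * r + 1, 5 * k + r + 14, -7 * k + r - 15)])"
  have cover: False
    if k: "0 \<le> k" and x: "1 \<le> x" "x \<le> 12 * k + 27"
      and S: "\<forall>c\<in>set (S k). x \<notin> signed_entries c"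
      and B: "\<And>r. 0 \<le> r \<Longrightarrow> r < k \<Longrightarrow> \<forall>c\<in>set (B k r). x \<notin> signed_entries c" for k x :: int
  proof -
    note B = B[unfolded B_def, simplified]
    have i1: "odd x \<longrightarrow> \<not> (3 \<le> x \<and> x \<le> 2 * k + 1)"
      using B[of "(2 * k + 1 - x) div 2"] by (auto elim!: evenE oddE)
    have i2: "even x \<longrightarrow> \<not> (10 \<le> x \<and> x \<le> 2 * k + 8)"
      using B[of "(2 * k + 8 - x) div 2"] by (auto elim!: evenE oddE)
    have i3: "odd x \<longrightarrow> \<not> (2 * k + 9 \<le> x \<and> x \<le> 4 * k + 7)"
      using B[of "(4 * k + 7 - x) div 2"] by (auto elim!: evenE oddE)
    have i4: "even x \<longrightarrow> \<not> (2 * k + 10 \<le> x \<and> x \<le> 4 * k + 8)"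
      using B[of "(4 * k + 8 - x) div 2"] by (auto elim!: evenE oddE)
    have i5: "\<not> (4 * k + 10 \<le> x \<and> x \<le> 5 * k + 9)"
      using B[of "x - (4 * k + 10)"] by auto
    have i6: "\<not> (5 * k + 14 \<le> x \<and> x \<le> 6 * k + 13)"
      using B[of "x - (5 * k + 14)"] by auto
    have i7: "\<not> (6 * k + 16 \<le> x \<and> x \<le> 7 * k + 15)"
      using B[of "7 * k + 15 - x"] by auto
    have i8: "\<not> (7 * k + 18 \<le> x \<and> x \<le> 8 * k + 17)"
      using B[of "8 * k + 17 - x"] by auto
    have i9: "\<not> (8 * k + 19 \<le> x \<and> x \<le> 9 * k + 18)"
      using B[of "x - (8 * k + 19)"] by auto
    have i10: "\<not> (9 * k + 19 \<le> x \<and> x \<le> 10 * k + 18)"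
      using B[of "x - (9 * k + 19)"] by auto
    have i11: "\<not> (10 * k + 28 \<le> x \<and> x \<le> 11 * k + 27)"
      using B[of "11 * k + 27 - x"] by auto
    have i12: "\<not> (11 * k + 28 \<le> x \<and> x \<le> 12 * k + 27)"
      using B[of "12 * k + 27 - x"] by auto
    note S = S[unfolded S_def, simplified]
    obtain y where "x = 2 * y \<or> x = 2 * y + 1"
      by (metis evenE oddE)
    then show False
      using k x S i1 i2 i3 i4 i5 i6 i7 i8 i9 i10 i11 i12 by (elim disjE; simp; smt (z3))
  qed
  show ?thesis
  proof (rule heffter_array_of_blocks(1)[where S = "S (int k)" and B = "B (int k)"
        and k = k and p = "-6" and q = "4" and s = "2" and N = "0"])
    show False
      if "1 \<le> x" "x \<le> 3 * int (4 * k + 9)" "\<forall>c\<in>set (S (int k)). x \<notin> signed_entries c"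
        and "\<And>r. 0 \<le> r \<Longrightarrow> r < int k \<Longrightarrow> \<forall>c\<in>set (B (int k) r). x \<notin> signed_entries c" for x
      using cover[of "int k" x] that by simp
  qed (simp_all add: S_def B_def algebra_simps)
qed

section \<open>The orders 3, 4 and 5, below the range of the families\<close>

lemma heffter_array_3_3: "\<exists>A. heffter_array 3 3 A"
proof -
  \<comment> \<open>The last column and the last row sum to -19, the negated modulus; all other sums
    are 0.\<close>
  define cs :: "(int \<times> int \<times> int) list" where "cs = [(1, 3, -4), (7, 2, -9), (-8, -5, -6)]"
  have "heffter_array 3 (length cs) (array_of_columns cs)"
  proof (rule heffter_array_of_columns(2)[where N = 19])
    show "\<exists>c\<in>set cs. x \<in> signed_entries c" if "1 \<le> x" "x \<le> 3 * int (length cs)" for x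
      using that unfolding cs_def by simp presburger
  qed (auto simp: cs_def)
  moreover have "length cs = 3"
    by (simp add: cs_def)
  ultimately show ?thesis by metis
qed

lemma integer_heffter_array_3_4: "\<exists>A. integer_heffter_array 3 4 A"
proof -
  define cs :: "(int \<times> int \<times> int) list" where
    "cs = [(1, 8, -9), (2, -12, 10), (3, -7, 4), (-6, 11, -5)]"
  have "integer_heffter_array 3 (length cs) (array_of_columns cs)"
  proof (rule heffter_array_of_columns(1)[where N = 0])
    show "\<exists>c\<in>set cs. x \<in> signed_entries c" if "1 \<le> x" "x \<le> 3 * int (length cs)" for x
      using that unfolding cs_def by simp presburger
  qed (auto simp: cs_def)
  moreover have "length cs = 4"
    by (simp add: cs_def)
  ultimately show ?thesis by metis
qed

lemma integer_heffter_array_3_5: "\<exists>A. integer_heffter_array 3 5 A"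
proof -
  define cs :: "(int \<times> int \<times> int) list" where
    "cs = [(1, 5, -6), (-10, -2, 12), (3, -14, 11), (13, -4, -9), (-7, 15, -8)]"
  have "integer_heffter_array 3 (length cs) (array_of_columns cs)"
  proof (rule heffter_array_of_columns(1)[where N = 0])
    show "\<exists>c\<in>set cs. x \<in> signed_entries c" if "1 \<le> x" "x \<le> 3 * int (length cs)" for x
      using that unfolding cs_def by simp presburger
  qed (auto simp: cs_def)
  moreover have "length cs = 5"
    by (simp add: cs_def)
  ultimately show ?thesis by metis
qed

theorem theorem6:
  fixes n :: nat
  assumes "n \<ge> 3"
  shows "(\<exists>A. heffter_array 3 n A) \<and>
    ([n = 0] (mod 4) \<or> [n = 1] (mod 4) \<longrightarrow>
      (\<exists>A. heffter_array 3 n A \<and> integer_heffter_array 3 n A))"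
proof -
  have "\<exists>k. n = 3 \<or> n = 4 \<or> n = 5 \<or> n = 4 * k + 6 \<or> n = 4 * k + 7 \<or> n = 4 * k + 8 \<or> n = 4 * k + 9"
    using assms by presburger
  \<comment> \<open>The first set has the residues 0 and 1 modulo 4, where one integer array settles
    both claims; the second has 2 and 3, where the second claim is vacuous.\<close>
  then obtain k where "n \<in> {4, 5, 4 * k + 8, 4 * k + 9} \<or> n \<in> {3, 4 * k + 6, 4 * k + 7}"
    by auto
  then show ?thesis
  proof
    assume "n \<in> {4, 5, 4 * k + 8, 4 * k + 9}"
    then have "\<exists>A. integer_heffter_array 3 n A"
      using integer_heffter_array_3_4 integer_heffter_array_3_5
        integer_heffter_array_3_4k_plus_8[of k] integer_heffter_array_3_4k_plus_9[of k] by auto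
    then show ?thesis
      using integer_heffter_array_imp_heffter_array by blast
  next
    assume n: "n \<in> {3, 4 * k + 6, 4 * k + 7}"
    then have "\<exists>A. heffter_array 3 n A"
      using heffter_array_3_3 heffter_array_3_4k_plus_6[of k] heffter_array_3_4k_plus_7[of k] by auto
    moreover have "\<not> ([n = 0] (mod 4) \<or> [n = 1] (mod 4))"
      using n by (auto simp: cong_def; presburger)
    ultimately show ?thesis by blast
  qed
qed

end
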